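(* Let $N\ge 2$, let $C=(c_{ij})\in M_N(\mathbb{R})$, and let $f:[0,1]\to\mathbb{R}$ be strictly convex and continuous with $f\in C^1((0,1])$. For $x,y\in\mathcal{P}_N$ and $\gamma>0$, let $P^\gamma=(p^\gamma_{ij})\in\Pi(x,y)$ be an $(f,\gamma)$-coupling. Assume that $f'(0)=-\infty$. Then $$\operatorname{supp}P^\gamma=\operatorname{supp}x\otimes y,$$ and there exist real numbers $(\alpha_i)_{i\in\operatorname{supp}x}$ and $(\beta_j)_{j\in\operatorname{supp}y}$ such that $$c_{ij}+\gamma\left(f'(p^\gamma_{ij})-f'(x_iy_j)\right)=\alpha_i+\beta_j\qquad\text{for all }(i,j)\in\operatorname{supp}x\otimes y.$$
   Context: $\mathcal{P}_N=\{x\in\mathbb{R}^N: x_i\ge 0,\ \sum_i x_i=1\}$. For $x,y\in\mathcal{P}_N$, $\Pi(x,y)$ is the set of couplings: matrices $\Pi=(\pi_{ij})\in M_N(\mathbb{R})$ with $\pi_{ij}\ge 0$, $\sum_k\pi_{ik}=x_i$, $\sum_k\pi_{kj}=y_j$ for all $i,j$. $(x\otimes y)_{ij}=x_iy_j$. $\operatorname{supp}x=\{i: x_i\ne 0\}$ and $\operatorname{supp}\Pi=\{(i,j):\pi_{ij}\ne 0\}$; thus $\operatorname{supp}x\otimes y=\operatorname{supp}x\times\operatorname{supp}y$. $\langle C,\Pi\rangle=\sum_{i,j}c_{ij}\pi_{ij}$. Bregman divergence: $f'(0):=\lim_{\varepsilon\downarrow 0}f'(\varepsilon)\in[-\infty,\infty)$,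 with the convention $\pm\infty\cdot 0=0$; $D_f(r,r_0)=f(r)-f(r_0)-f'(r_0)(r-r_0)$ for $r,r_0\in[0,1]$, and $\mathcal{D}_f(\Pi,\widetilde\Pi)=\sum_{i,j=1}^N D_f(\pi_{ij},\widetilde\pi_{ij})$. (For $\Pi\in\Pi(x,y)$, the entries with $x_iy_j=0$ contribute $0$ to $\mathcal{D}_f(\Pi,x\otimes y)$, which is finite and nonnegative.) $\mathcal{F}^\gamma_{x,y}(\Pi)=\langle C,\Pi\rangle+\gamma\mathcal{D}_f(\Pi,x\otimes y)$ on $\Pi(x,y)$; an $(f,\gamma)$-coupling between $x,y$ is a minimizer of $\mathcal{F}^\gamma_{x,y}$ over $\Pi(x,y)$. *)

theory Defs
  imports "HOL-Analysis.Analysis"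
begin

text \<open>The dimension \<open>N\<close> is \<open>CARD('n)\<close> for a finite index type \<open>'n\<close>.\<close>

definition prob_simplex :: "(real ^ 'n) set" where
  "prob_simplex = {x. (\<forall>i. 0 \<le> x $ i) \<and> (\<Sum>i\<in>UNIV. x $ i) = 1}"

definition couplings :: "real ^ 'n \<Rightarrow> real ^ 'n \<Rightarrow> (real ^ 'n ^ 'n) set" where
  "couplings x y =
     {P. (\<forall>i j. 0 \<le> P $ i $ j) \<and>
         (\<forall>i. (\<Sum>k\<in>UNIV. P $ i $ k) = x $ i) \<and>
         (\<forall>j. (\<Sum>k\<in>UNIV. P $ k $ j) = y $ j)}"

definition tensor :: "real ^ 'n \<Rightarrow> real ^ 'n \<Rightarrow> real ^ 'n ^ 'n" where
  "tensor x y = (\<chi> i j. x $ i * y $ j)"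

definition vec_supp :: "real ^ 'n \<Rightarrow> 'n set" where
  "vec_supp x = {i. x $ i \<noteq> 0}"

definition mat_supp :: "real ^ 'n ^ 'n \<Rightarrow> ('n \<times> 'n) set" where
  "mat_supp P = {(i, j). P $ i $ j \<noteq> 0}"

lemma mat_supp_tensor: "mat_supp (tensor x y) = vec_supp x \<times> vec_supp y"
  by (auto simp: mat_supp_def tensor_def vec_supp_def)

definition mat_pairing :: "real ^ 'n ^ 'n \<Rightarrow> real ^ 'n ^ 'n \<Rightarrow> real" where
  "mat_pairing C P = (\<Sum>i\<in>UNIV. \<Sum>j\<in>UNIV. C $ i $ j * P $ i $ j)"

definition strictly_convex_on :: "real set \<Rightarrow> (real \<Rightarrow> real) \<Rightarrow> bool" where
  "strictly_convex_on S f \<longleftrightarrow> convex S \<and>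
     (\<forall>r\<in>S. \<forall>s\<in>S. \<forall>t. r \<noteq> s \<longrightarrow> 0 < t \<longrightarrow> t < 1 \<longrightarrow>
        f ((1 - t) * r + t * s) < (1 - t) * f r + t * f s)"

text \<open>
  A function on \<open>[0,1]\<close> is represented by a total function on the reals whose values outside
  \<open>[0,1]\<close> are irrelevant. Accordingly derivatives are taken within \<open>(0,1]\<close>, which gives the
  two-sided derivative on \<open>(0,1)\<close> and the left derivative at \<open>1\<close>.
\<close>

definition C1_on_Ioc01 :: "(real \<Rightarrow> real) \<Rightarrow> bool" where
  "C1_on_Ioc01 f \<longleftrightarrow> f differentiable_on {0<..1} \<and>
     continuous_on {0<..1} (\<lambda>r. vector_derivative f (at r within {0<..1}))"

text \<open>
  \<open>ext_deriv f\<close> is \<open>f'\<close> on \<open>[0,1]\<close>, with \<open>f'(0)\<close> the possibly infinite limit of \<open>f'\<close> from the right.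
\<close>

definition ext_deriv :: "(real \<Rightarrow> real) \<Rightarrow> real \<Rightarrow> ereal" where
  "ext_deriv f r =
     (if r = 0 then Lim (at_right 0) (\<lambda>e. ereal (vector_derivative f (at e within {0<..1})))
      else ereal (vector_derivative f (at r within {0<..1})))"

text \<open>
  The convention \<open>\<plusminus>\<infinity> \<cdot> 0 = 0\<close> is the one built into multiplication on \<^typ>\<open>ereal\<close>. If
  \<open>f'(0) = -\<infinity>\<close>, then \<open>D\<^sub>f(r,0) = \<infinity>\<close> for \<open>r > 0\<close>, so the divergence is \<^typ>\<open>ereal\<close>-valued.
\<close>

definition bregman :: "(real \<Rightarrow> real) \<Rightarrow> real \<Rightarrow> real \<Rightarrow> ereal" where
  "bregman f r r0 = ereal (f r) - ereal (f r0) - ext_deriv f r0 * ereal (r - r0)"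

definition mat_bregman :: "(real \<Rightarrow> real) \<Rightarrow> real ^ 'n ^ 'n \<Rightarrow> real ^ 'n ^ 'n \<Rightarrow> ereal" where
  "mat_bregman f P Q = (\<Sum>i\<in>UNIV. \<Sum>j\<in>UNIV. bregman f (P $ i $ j) (Q $ i $ j))"

definition reg_cost ::
  "real ^ 'n ^ 'n \<Rightarrow> (real \<Rightarrow> real) \<Rightarrow> real \<Rightarrow> real ^ 'n \<Rightarrow> real ^ 'n \<Rightarrow> real ^ 'n ^ 'n \<Rightarrow> ereal"
where
  "reg_cost C f \<gamma> x y P =
     ereal (mat_pairing C P) + ereal \<gamma> * mat_bregman f P (tensor x y)"

definition is_reg_coupling ::
  "real ^ 'n ^ 'n \<Rightarrow> (real \<Rightarrow> real) \<Rightarrow> real \<Rightarrow> real ^ 'n \<Rightarrow> real ^ 'n \<Rightarrow> real ^ 'n ^ 'n \<Rightarrow> bool"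
where
  "is_reg_coupling C f \<gamma> x y P \<longleftrightarrow>
     is_arg_min (reg_cost C f \<gamma> x y) (\<lambda>Q. Q \<in> couplings x y) P"

end

theory Submission
  imports Defs
begin

text \<open>
  Write \<open>w = tensor x y\<close>, \<open>g = f'\<close> and \<open>m i j = C i j + \<gamma> (g (P i j) - g (w i j))\<close>. The argument is
  the first-order condition for a minimizer over the transport polytope, in which convexity of \<open>f\<close>
  replaces differentiation of the cost. By the tangent line inequality at the entries of a
  competitor \<open>Q\<close>, minimality of \<open>P\<close> gives the variational inequality
  \<open>0 \<le> (\<Sum>i j. (Q i j - P i j) (C i j + \<gamma> (g (Q i j) - g (w i j))))\<close>, provided that \<open>Q\<close> is positive
  on the support of \<open>w\<close> (\<open>minimizer_variational_inequality\<close>). The derivative is evaluated at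
  \<open>Q\<close>, so that the inequality also makes sense when \<open>P\<close> has zeros at which \<open>g\<close> is infinite.

  For the support, take \<open>Q = P + t (w - P)\<close>. Since \<open>Q\<close> lies between \<open>P\<close> and \<open>w\<close> and \<open>g\<close> is
  increasing, no entry of \<open>(w - P) (g Q - g w)\<close> is positive. At an entry where \<open>P\<close> vanishes and
  \<open>w\<close> is positive it is \<open>w (g (t w) - g w)\<close>, which tends to \<open>-\<infinity>\<close> as \<open>t\<close> decreases to \<open>0\<close>,
  whereas the contribution of \<open>C\<close> does not depend on \<open>t\<close>: a contradiction
  (\<open>minimizer_pos_on_support\<close>).

  Once \<open>P\<close> is positive on the support of \<open>w\<close>, it may be moved in every direction \<open>D\<close> supported
  there with vanishing row and column sums. Letting the step tend to \<open>0\<close>, continuity of \<open>g\<close> shows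
  that \<open>m\<close> is orthogonal to all such \<open>D\<close> (\<open>minimizer_stationary\<close>). The directions that
  alternate in sign around a rectangle in \<open>vec_supp x \<times> vec_supp y\<close> show that the mixed
  second differences of \<open>m\<close> vanish there, and this is precisely the condition for \<open>m i j\<close> to split as
  \<open>\<alpha> i + \<beta> j\<close>.
\<close>

section \<open>The derivative of a convex function on the unit interval\<close>

abbreviation deriv01 :: "(real \<Rightarrow> real) \<Rightarrow> real \<Rightarrow> real" where
  "deriv01 f r \<equiv> vector_derivative f (at r within {0<..1})"

lemma C1_has_deriv01:
  assumes "C1_on_Ioc01 f" and "r \<in> {0<..1}"
  shows "(f has_real_derivative deriv01 f r) (at r within {0<..1})"
  using assms
  by (simp add: C1_on_Ioc01_def differentiable_on_def has_real_derivative_iff_has_vector_derivative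
      vector_derivative_works)

text \<open>
  The chord from \<open>s\<close> towards \<open>r\<close> lies above the graph, so the difference quotients of \<open>f\<close> along it
  are at most \<open>f r - f s\<close>. Taking them along the segment rather than along the real line treats
  the endpoint \<open>s = 1\<close>, where only a left derivative exists, like the interior points.
\<close>

lemma tangent_le:
  assumes conv: "strictly_convex_on {0..1} f" and C1: "C1_on_Ioc01 f"
    and s: "s \<in> {0<..1}" and r: "r \<in> {0..1}"
  shows "deriv01 f s * (r - s) \<le> f r - f s"
proof (cases "r = s")
  case False
  define p where "p = (\<lambda>t. s + t * (r - s))"
  have p_in: "p t \<in> {0<..1}" if "t \<in> {0..<1}" for t
  proof -
    have eq: "p t = (1 - t) * s + t * r"
      by (simp add: p_def algebra_simps)
    have "0 < (1 - t) * s" "0 \<le> t * r" "(1 - t) * s \<le> 1 - t" "t * r \<le> t"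
      using that s r by (auto simp: mult_left_le)
    then show ?thesis unfolding eq by simp
  qed
  have dp: "(p has_real_derivative (r - s)) (at 0 within {0..<1})"
    unfolding p_def by (auto intro!: derivative_eq_intros)
  have "(f has_real_derivative deriv01 f (p 0)) (at (p 0) within p ` {0..<1})"
  proof (rule DERIV_subset)
    show "(f has_real_derivative deriv01 f (p 0)) (at (p 0) within {0<..1})"
      using C1_has_deriv01[OF C1 s] by (simp add: p_def)
  qed (use p_in in blast)
  then have "((f \<circ> p) has_real_derivative deriv01 f (p 0) * (r - s)) (at 0 within {0..<1})"
    using dp by (rule DERIV_image_chain)
  then have lim: "((\<lambda>t. (f (p t) - f s) / t) \<longlongrightarrow> deriv01 f s * (r - s)) (at 0 within {0..<1})"
    by (simp add: has_field_derivative_iff p_def)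
  have "eventually (\<lambda>t. (f (p t) - f s) / t \<le> f r - f s) (at 0 within {0..<1})"
    unfolding eventually_at_filter
  proof (intro always_eventually allI impI)
    fix t :: real assume t: "t \<noteq> 0" "t \<in> {0..<1}"
    have "f ((1 - t) * s + t * r) < (1 - t) * f s + t * f r"
      using conv s r t False unfolding strictly_convex_on_def by auto
    moreover have "(1 - t) * s + t * r = p t"
      by (simp add: p_def algebra_simps)
    ultimately show "(f (p t) - f s) / t \<le> f r - f s"
      using t by (simp add: field_simps)
  qed
  moreover have "at (0::real) within {0..<1} \<noteq> bot"
  proof -
    have "{0..<1::real} - {0} = {0<..<1}"
      by auto
    then show ?thesis
      by (simp add: at_within_eq_bot_iff)
  qed
  ultimately show ?thesis
    using lim by (intro tendsto_upperbound[of _ _ "at 0 within {0..<1}"]) auto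
qed simp

lemma deriv01_mono:
  assumes "strictly_convex_on {0..1} f" and "C1_on_Ioc01 f"
    and "0 < s" "s \<le> r" "r \<le> 1"
  shows "deriv01 f s \<le> deriv01 f r"
proof (cases "s = r")
  case False
  have "deriv01 f s * (r - s) \<le> f r - f s" "deriv01 f r * (s - r) \<le> f s - f r"
    using assms by (auto intro!: tangent_le)
  then have "(deriv01 f s - deriv01 f r) * (r - s) \<le> 0"
    by (simp add: algebra_simps)
  with False assms show ?thesis
    by (simp add: mult_le_0_iff)
qed simp

text \<open>
  The number \<open>ext_deriv f 0\<close> is defined through \<^const>\<open>Lim\<close>, whose value is meaningful only if the
  limit exists. It does exist in the extended reals, as the infimum, because the derivative is
  monotone.
\<close>

lemma deriv01_unbounded_below:
  assumes conv: "strictly_convex_on {0..1} f" and C1: "C1_on_Ioc01 f"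
    and inf: "ext_deriv f 0 = -\<infinity>"
  shows "\<exists>e\<in>{0<..1}. deriv01 f e < K"
proof -
  define l where "l = (INF e\<in>{0<..1}. ereal (deriv01 f e))"
  have "((\<lambda>e. ereal (deriv01 f e)) \<longlongrightarrow> l) (at_right 0)"
  proof (rule order_tendstoI)
    fix a assume a: "a < l"
    have "a < ereal (deriv01 f e)" if "e \<in> {0<..1}" for e
      using a INF_lower[OF that, of "\<lambda>e. ereal (deriv01 f e)"] unfolding l_def by order
    then show "\<forall>\<^sub>F e in at_right 0. a < ereal (deriv01 f e)"
      by (auto simp: eventually_at_right_field intro!: exI[of _ 1])
  next
    fix a assume "l < a"
    then obtain e where e: "e \<in> {0<..1}" "ereal (deriv01 f e) < a"
      unfolding l_def INF_less_iff by blast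
    have "ereal (deriv01 f s) < a" if "0 < s" "s < e" for s
      using deriv01_mono[OF conv C1, of s e] that e
      by (metis ereal_less_eq(3) greaterThanAtMost_iff le_less_trans less_imp_le)
    then show "\<forall>\<^sub>F s in at_right 0. ereal (deriv01 f s) < a"
      using e by (auto simp: eventually_at_right_field intro!: exI[of _ e])
  qed
  then have "Lim (at_right 0) (\<lambda>e. ereal (deriv01 f e)) = l"
    by (intro tendsto_Lim) auto
  then have "l < ereal K"
    using inf by (simp add: ext_deriv_def)
  then show ?thesis
    unfolding l_def INF_less_iff by auto
qed

section \<open>Couplings and the regularized cost\<close>

lemma coupling_entry_nonneg: "Q \<in> couplings x y \<Longrightarrow> 0 \<le> Q $ i $ j"
  by (simp add: couplings_def)

lemma coupling_entry_le:
  assumes "Q \<in> couplings x y"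
  shows "Q $ i $ j \<le> x $ i" and "Q $ i $ j \<le> y $ j"
proof -
  have "Q $ i $ j \<le> (\<Sum>k\<in>UNIV. Q $ i $ k)"
    using assms by (intro member_le_sum) (auto simp: couplings_def)
  moreover have "Q $ i $ j \<le> (\<Sum>k\<in>UNIV. Q $ k $ j)"
    using assms by (intro member_le_sum[of i UNIV "\<lambda>k. Q $ k $ j"]) (auto simp: couplings_def)
  ultimately show "Q $ i $ j \<le> x $ i" "Q $ i $ j \<le> y $ j"
    using assms by (auto simp: couplings_def)
qed

lemma prob_simplex_entry:
  assumes "x \<in> prob_simplex" shows "0 \<le> x $ i" and "x $ i \<le> 1"
proof -
  show "0 \<le> x $ i" using assms by (simp add: prob_simplex_def)
  have "x $ i \<le> (\<Sum>k\<in>UNIV. x $ k)"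
    using assms by (intro member_le_sum) (auto simp: prob_simplex_def)
  then show "x $ i \<le> 1" using assms by (simp add: prob_simplex_def)
qed

lemma coupling_entry_in_unit:
  assumes "x \<in> prob_simplex" and "Q \<in> couplings x y"
  shows "Q $ i $ j \<in> {0..1}"
  using coupling_entry_nonneg[OF assms(2), of i j] coupling_entry_le(1)[OF assms(2), of i j]
    prob_simplex_entry(2)[OF assms(1), of i] by simp

lemma coupling_zero_off_support:
  assumes "Q \<in> couplings x y" and "tensor x y $ i $ j = 0"
  shows "Q $ i $ j = 0"
  using coupling_entry_nonneg[OF assms(1), of i j] coupling_entry_le[OF assms(1), of i j] assms(2)
  by (auto simp: tensor_def)

lemma tensor_in_couplings:
  assumes "x \<in> prob_simplex" and "y \<in> prob_simplex"
  shows "tensor x y \<in> couplings x y"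
  using assms
  by (simp add: couplings_def prob_simplex_def tensor_def flip: sum_distrib_left sum_distrib_right)

lemma coupling_add_balanced:
  assumes "P \<in> couplings x y"
    and "\<And>i. (\<Sum>j\<in>UNIV. D $ i $ j) = 0" and "\<And>j. (\<Sum>i\<in>UNIV. D $ i $ j) = 0"
    and "\<And>i j. 0 \<le> P $ i $ j + t * D $ i $ j"
  shows "P + t *\<^sub>R D \<in> couplings x y"
  using assms by (simp add: couplings_def sum.distrib flip: sum_distrib_left)

text \<open>
  On couplings the extended-real cost is finite, because entries with \<open>x i * y j = 0\<close> contribute
  \<open>0\<close>. The formula below is also correct at these entries: the value of \<open>deriv01 f 0\<close>
  in it is multiplied by \<open>0\<close>.
\<close>

lemma reg_cost_coupling:
  assumes "Q \<in> couplings x y"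
  shows "reg_cost C f \<gamma> x y Q = ereal (\<Sum>i\<in>UNIV. \<Sum>j\<in>UNIV. C $ i $ j * Q $ i $ j +
      \<gamma> * (f (Q $ i $ j) - f (tensor x y $ i $ j)
        - deriv01 f (tensor x y $ i $ j) * (Q $ i $ j - tensor x y $ i $ j)))"
proof -
  have "bregman f (Q $ i $ j) (tensor x y $ i $ j) = ereal (f (Q $ i $ j) - f (tensor x y $ i $ j)
        - deriv01 f (tensor x y $ i $ j) * (Q $ i $ j - tensor x y $ i $ j))" for i j
    using coupling_zero_off_support[OF assms, of i j]
    by (cases "tensor x y $ i $ j = 0") (simp_all add: bregman_def ext_deriv_def flip: zero_ereal_def)
  then show ?thesis
    by (simp add: reg_cost_def mat_bregman_def mat_pairing_def sum.distrib sum_distrib_left)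
qed

section \<open>First-order conditions for a minimizer\<close>

text \<open>
  The cost difference between \<open>Q\<close> and \<open>P\<close> is nonnegative, and the tangent line to \<open>f\<close> at
  each entry of \<open>Q\<close> bounds it from above by the sum in the conclusion. Entries with
  \<open>Q i j = P i j\<close> contribute \<open>0\<close> to both, so positivity, which \<open>f\<close> needs for a tangent line, is asked
  only of the entries that move.
\<close>

lemma minimizer_variational_inequality:
  fixes C P Q :: "real ^ 'n ^ 'n"
  assumes conv: "strictly_convex_on {0..1} f" and C1: "C1_on_Ioc01 f"
    and x: "x \<in> prob_simplex" and \<gamma>: "\<gamma> > 0"
    and min: "is_reg_coupling C f \<gamma> x y P" and Q: "Q \<in> couplings x y"
    and pos: "\<And>i j. Q $ i $ j = P $ i $ j \<or> 0 < Q $ i $ j"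
  shows "0 \<le> (\<Sum>i\<in>UNIV. \<Sum>j\<in>UNIV. (Q $ i $ j - P $ i $ j) *
      (C $ i $ j + \<gamma> * (deriv01 f (Q $ i $ j) - deriv01 f (tensor x y $ i $ j))))"
proof -
  let ?w = "tensor x y"
  define F where "F = (\<lambda>R :: real^'n^'n. \<lambda>i j. C $ i $ j * R $ i $ j + \<gamma> * (f (R $ i $ j) - f (?w $ i $ j)
        - deriv01 f (?w $ i $ j) * (R $ i $ j - ?w $ i $ j)))"
  have P: "P \<in> couplings x y"
    using min by (simp add: is_reg_coupling_def is_arg_min_def)
  have "\<not> reg_cost C f \<gamma> x y Q < reg_cost C f \<gamma> x y P"
    using min Q by (simp add: is_reg_coupling_def is_arg_min_def)
  then have "0 \<le> (\<Sum>i\<in>UNIV. \<Sum>j\<in>UNIV. F Q i j - F P i j)"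
    by (simp add: reg_cost_coupling P Q F_def sum_subtractf)
  also have "\<dots> \<le> (\<Sum>i\<in>UNIV. \<Sum>j\<in>UNIV. (Q $ i $ j - P $ i $ j) *
      (C $ i $ j + \<gamma> * (deriv01 f (Q $ i $ j) - deriv01 f (?w $ i $ j))))"
  proof (intro sum_mono)
    fix i j
    have "f (Q $ i $ j) - f (P $ i $ j) \<le> deriv01 f (Q $ i $ j) * (Q $ i $ j - P $ i $ j)"
    proof (cases "Q $ i $ j = P $ i $ j")
      case False
      then have "deriv01 f (Q $ i $ j) * (P $ i $ j - Q $ i $ j) \<le> f (P $ i $ j) - f (Q $ i $ j)"
        using coupling_entry_in_unit[OF x P, of i j] coupling_entry_in_unit[OF x Q, of i j] pos[of i j]
        by (intro tangent_le[OF conv C1]) auto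
      then show ?thesis by (simp add: algebra_simps)
    qed simp
    then have "\<gamma> * (f (Q $ i $ j) - f (P $ i $ j))
        \<le> \<gamma> * (deriv01 f (Q $ i $ j) * (Q $ i $ j - P $ i $ j))"
      using \<gamma> by (intro mult_left_mono) auto
    then show "F Q i j - F P i j \<le> (Q $ i $ j - P $ i $ j) *
      (C $ i $ j + \<gamma> * (deriv01 f (Q $ i $ j) - deriv01 f (?w $ i $ j)))"
      by (simp add: F_def algebra_simps)
  qed
  finally show ?thesis .
qed

text \<open>
  Moving mass from \<open>P\<close> towards \<open>x \<otimes> y\<close> costs at most linearly in the step, while filling a zero
  entry of \<open>P\<close> gains at an infinite rate because \<open>f' 0 = -\<infinity>\<close>.
\<close>

lemma minimizer_pos_on_support:
  fixes C P :: "real ^ 'n ^ 'n"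
  assumes conv: "strictly_convex_on {0..1} f" and C1: "C1_on_Ioc01 f"
    and x: "x \<in> prob_simplex" and y: "y \<in> prob_simplex" and \<gamma>: "\<gamma> > 0"
    and min: "is_reg_coupling C f \<gamma> x y P" and inf: "ext_deriv f 0 = -\<infinity>"
    and ab: "tensor x y $ a $ b \<noteq> 0"
  shows "0 < P $ a $ b"
proof (rule ccontr)
  let ?w = "tensor x y"
  let ?D = "tensor x y - P"
  have P: "P \<in> couplings x y"
    using min by (simp add: is_reg_coupling_def is_arg_min_def)
  have w: "?w \<in> couplings x y"
    by (rule tensor_in_couplings[OF x y])
  note w01 = coupling_entry_in_unit[OF x w] and P01 = coupling_entry_in_unit[OF x P]
  assume "\<not> 0 < P $ a $ b"
  then have Pab: "P $ a $ b = 0"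
    using P01[of a b] by simp
  have wab: "0 < ?w $ a $ b" using ab w01[of a b] by simp
  define K where "K = (\<Sum>i\<in>UNIV. \<Sum>j\<in>UNIV. ?D $ i $ j * C $ i $ j)"
  obtain e where e: "e \<in> {0<..1}" "deriv01 f e < deriv01 f (?w $ a $ b) - K / (\<gamma> * ?w $ a $ b)"
    using deriv01_unbounded_below[OF conv C1 inf] by blast
  \<comment> \<open>the step for which the entry at \<open>(a, b)\<close> becomes \<open>min (w a b) e\<close>\<close>
  define t where "t = min 1 (e / ?w $ a $ b)"
  have t: "0 < t" "t \<le> 1" "t * ?w $ a $ b \<le> e"
    using e wab by (auto simp: t_def min_def field_simps)
  define Q where "Q = P + t *\<^sub>R ?D"
  have Q_eq: "Q $ i $ j = (1 - t) * P $ i $ j + t * ?w $ i $ j" for i j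
    by (simp add: Q_def algebra_simps)
  have Q: "Q \<in> couplings x y"
    unfolding Q_def
  proof (rule coupling_add_balanced[OF P])
    show "0 \<le> P $ i $ j + t * ?D $ i $ j" for i j
      using Q_eq[of i j] t P01[of i j] w01[of i j] by (simp add: Q_def)
  qed (use P w in \<open>simp_all add: couplings_def sum_subtractf\<close>)
  have Q_pos: "0 < Q $ i $ j" if "?w $ i $ j \<noteq> 0" for i j
    using that t P01[of i j] w01[of i j] unfolding Q_eq by (intro add_nonneg_pos) auto
  have "Q $ i $ j = P $ i $ j \<or> 0 < Q $ i $ j" for i j
    using Q_pos coupling_zero_off_support[OF P] coupling_zero_off_support[OF Q] by metis
  from minimizer_variational_inequality[OF conv C1 x \<gamma> min Q this]
  have "0 \<le> t * (\<Sum>i\<in>UNIV. \<Sum>j\<in>UNIV. ?D $ i $ j *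
      (C $ i $ j + \<gamma> * (deriv01 f (Q $ i $ j) - deriv01 f (?w $ i $ j))))"
    by (simp add: Q_def sum_distrib_left mult.assoc)
  then have "0 \<le> (\<Sum>i\<in>UNIV. \<Sum>j\<in>UNIV. ?D $ i $ j *
      (C $ i $ j + \<gamma> * (deriv01 f (Q $ i $ j) - deriv01 f (?w $ i $ j))))"
    using t by (simp only: zero_le_mult_iff) auto
  then have gain: "0 \<le> K + \<gamma> * (\<Sum>i\<in>UNIV. \<Sum>j\<in>UNIV.
      ?D $ i $ j * (deriv01 f (Q $ i $ j) - deriv01 f (?w $ i $ j)))"
    by (simp add: K_def sum_distrib_left sum.distrib distrib_left mult.left_commute)
  \<comment> \<open>every entry is nonpositive by monotonicity, so all but \<open>(a, b)\<close> can be dropped\<close>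
  have neg: "?D $ i $ j * (deriv01 f (Q $ i $ j) - deriv01 f (?w $ i $ j)) \<le> 0" for i j
  proof (cases "?w $ i $ j = 0")
    case True
    then show ?thesis using coupling_zero_off_support[OF P True] by simp
  next
    case False
    have Q01: "Q $ i $ j \<le> 1" "0 < Q $ i $ j"
      using coupling_entry_in_unit[OF x Q, of i j] Q_pos[OF False] by auto
    have diff: "?w $ i $ j - Q $ i $ j = (1 - t) * ?D $ i $ j"
      by (simp add: Q_eq algebra_simps)
    show ?thesis
    proof (cases "0 \<le> ?D $ i $ j")
      case True
      then have "Q $ i $ j \<le> ?w $ i $ j"
        using diff t by (smt (verit) mult_nonneg_nonneg)
      then show ?thesis
        using True deriv01_mono[OF conv C1, of "Q $ i $ j" "?w $ i $ j"] Q01 w01[of i j]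
        by (intro mult_nonneg_nonpos) auto
    next
      case False
      then have "?w $ i $ j \<le> Q $ i $ j"
        using diff t by (smt (verit) mult_nonneg_nonpos)
      then show ?thesis
        using False deriv01_mono[OF conv C1, of "?w $ i $ j" "Q $ i $ j"] Q01 w01[of i j] \<open>?w $ i $ j \<noteq> 0\<close>
        by (intro mult_nonpos_nonneg) auto
    qed
  qed
  have "(\<Sum>i\<in>UNIV. \<Sum>j\<in>UNIV. ?D $ i $ j * (deriv01 f (Q $ i $ j) - deriv01 f (?w $ i $ j)))
      \<le> ?D $ a $ b * (deriv01 f (Q $ a $ b) - deriv01 f (?w $ a $ b))"
  proof -
    let ?T = "\<lambda>i j. - (?D $ i $ j * (deriv01 f (Q $ i $ j) - deriv01 f (?w $ i $ j)))"
    have nn: "0 \<le> ?T i j" for i j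
      using neg[of i j] by simp
    have "?T a b \<le> (\<Sum>j\<in>UNIV. ?T a j)"
      using nn by (intro member_le_sum) auto
    also have "\<dots> \<le> (\<Sum>i\<in>UNIV. \<Sum>j\<in>UNIV. ?T i j)"
      using nn by (intro member_le_sum[of a UNIV "\<lambda>i. \<Sum>j\<in>UNIV. ?T i j"]) (auto intro!: sum_nonneg simp del: vector_minus_component)
    finally show ?thesis
      by (simp add: sum_negf)
  qed
  also have "\<dots> \<le> ?w $ a $ b * (deriv01 f e - deriv01 f (?w $ a $ b))"
    using deriv01_mono[OF conv C1, of "Q $ a $ b" e] Q_pos[OF ab] t e wab
    by (simp add: Pab Q_eq mult_left_mono)
  also have "\<dots> < ?w $ a $ b * (- (K / (\<gamma> * ?w $ a $ b)))"
    using e wab by (intro mult_strict_left_mono) auto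
  also have "\<dots> = - (K / \<gamma>)"
    using wab \<gamma> by simp
  finally have "\<gamma> * (\<Sum>i\<in>UNIV. \<Sum>j\<in>UNIV.
      ?D $ i $ j * (deriv01 f (Q $ i $ j) - deriv01 f (?w $ i $ j))) < - K"
    using \<gamma> by (simp add: field_simps)
  with gain show False by simp
qed

text \<open>
  Since \<open>P\<close> is positive on the finite set where \<open>D\<close> lives, \<open>P + t D\<close> is a competitor for all
  small \<open>t > 0\<close>. The inequality in the limit holds for \<open>- D\<close> as well, hence is an equality.
\<close>

lemma minimizer_stationary:
  fixes C P D :: "real ^ 'n ^ 'n"
  assumes conv: "strictly_convex_on {0..1} f" and C1: "C1_on_Ioc01 f"
    and x: "x \<in> prob_simplex" and \<gamma>: "\<gamma> > 0"
    and min: "is_reg_coupling C f \<gamma> x y P"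
    and rows: "\<And>i. (\<Sum>j\<in>UNIV. D $ i $ j) = 0" and cols: "\<And>j. (\<Sum>i\<in>UNIV. D $ i $ j) = 0"
    and pos: "\<And>i j. D $ i $ j \<noteq> 0 \<Longrightarrow> 0 < P $ i $ j"
  shows "(\<Sum>i\<in>UNIV. \<Sum>j\<in>UNIV. D $ i $ j *
      (C $ i $ j + \<gamma> * (deriv01 f (P $ i $ j) - deriv01 f (tensor x y $ i $ j)))) = 0"
proof -
  let ?w = "tensor x y"
  define S where "S = (\<lambda>E R :: real^'n^'n. \<Sum>i\<in>UNIV. \<Sum>j\<in>UNIV. E $ i $ j *
      (C $ i $ j + \<gamma> * (deriv01 f (R $ i $ j) - deriv01 f (?w $ i $ j))))"
  have P: "P \<in> couplings x y"
    using min by (simp add: is_reg_coupling_def is_arg_min_def)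
  have nonneg: "0 \<le> S E P"
    if rows: "\<And>i. (\<Sum>j\<in>UNIV. E $ i $ j) = 0" and cols: "\<And>j. (\<Sum>i\<in>UNIV. E $ i $ j) = 0"
      and pos: "\<And>i j. E $ i $ j \<noteq> 0 \<Longrightarrow> 0 < P $ i $ j" for E
  proof -
    have lim: "((\<lambda>t. P $ i $ j + t * E $ i $ j) \<longlongrightarrow> P $ i $ j) (at_right 0)" for i j
      by (auto intro!: tendsto_eq_intros)
    have "\<forall>\<^sub>F t in at_right 0. E $ i $ j = 0 \<or> 0 < P $ i $ j + t * E $ i $ j" for i j
      using order_tendstoD(1)[OF lim, of 0 i j] pos[of i j]
      by (cases "E $ i $ j = 0") auto
    then have "\<forall>\<^sub>F t in at_right 0. \<forall>i j. E $ i $ j = 0 \<or> 0 < P $ i $ j + t * E $ i $ j"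
      by (simp add: eventually_all_finite)
    then have adm: "\<forall>\<^sub>F t in at_right 0. P + t *\<^sub>R E \<in> couplings x y \<and>
        (\<forall>i j. E $ i $ j = 0 \<or> 0 < P $ i $ j + t * E $ i $ j) \<and> 0 < t"
      using eventually_at_right_less[of 0]
    proof eventually_elim
      case (elim t)
      then have "0 \<le> P $ i $ j + t * E $ i $ j" for i j
        using coupling_entry_nonneg[OF P, of i j] by (cases "E $ i $ j = 0") (auto intro: less_imp_le)
      with elim show ?case
        using coupling_add_balanced[OF P rows cols] by blast
    qed
    then have "\<forall>\<^sub>F t in at_right 0. 0 \<le> S E (P + t *\<^sub>R E)"
    proof eventually_elim
      case (elim t)
      then have "0 \<le> t * S E (P + t *\<^sub>R E)"
        using minimizer_variational_inequality[OF conv C1 x \<gamma> min, of "P + t *\<^sub>R E"]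
        by (simp add: S_def sum_distrib_left mult.assoc)
      with elim show ?case by (simp add: zero_le_mult_iff)
    qed
    moreover have "((\<lambda>t. S E (P + t *\<^sub>R E)) \<longlongrightarrow> S E P) (at_right 0)"
      unfolding S_def
    proof (intro tendsto_sum)
      fix i j
      show "((\<lambda>t. E $ i $ j * (C $ i $ j + \<gamma> * (deriv01 f ((P + t *\<^sub>R E) $ i $ j) - deriv01 f (?w $ i $ j))))
          \<longlongrightarrow> E $ i $ j * (C $ i $ j + \<gamma> * (deriv01 f (P $ i $ j) - deriv01 f (?w $ i $ j)))) (at_right 0)"
      proof (cases "E $ i $ j = 0")
        case False
        have "((\<lambda>t. deriv01 f (P $ i $ j + t * E $ i $ j)) \<longlongrightarrow> deriv01 f (P $ i $ j)) (at_right 0)"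
        proof (rule continuous_on_tendsto_compose[OF _ lim])
          show "continuous_on {0<..1} (deriv01 f)"
            using C1 by (simp add: C1_on_Ioc01_def)
          show "P $ i $ j \<in> {0<..1}"
            using pos[OF False] coupling_entry_in_unit[OF x P, of i j] by simp
          show "\<forall>\<^sub>F t in at_right 0. P $ i $ j + t * E $ i $ j \<in> {0<..1}"
            using adm
          proof eventually_elim
            case (elim t)
            then show ?case
              using False coupling_entry_in_unit[OF x, of "P + t *\<^sub>R E" y i j] by auto
          qed
        qed
        then show ?thesis
          by (auto intro!: tendsto_intros)
      qed simp
    qed
    ultimately show ?thesis
      by (intro tendsto_lowerbound[where F = "at_right 0"]) auto
  qed
  have "0 \<le> S D P"
    using rows cols pos by (rule nonneg)
  moreover have "0 \<le> S (- D) P"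
    using rows cols pos by (intro nonneg) (auto simp: sum_negf)
  then have "S D P \<le> 0"
    by (simp add: S_def sum_negf)
  ultimately show ?thesis
    by (simp add: S_def)
qed

section \<open>Splitting the multiplier\<close>

text \<open>
  The potentials are read off from one row and one column: with base point \<open>(i0, j0)\<close> take
  \<open>\<alpha> i = m i j0\<close> and \<open>\<beta> j = m i0 j - m i0 j0\<close>.
\<close>

lemma split_if_mixed_differences_vanish:
  fixes m :: "'a \<Rightarrow> 'b \<Rightarrow> real"
  assumes "\<And>i i' j j'. i \<in> A \<Longrightarrow> i' \<in> A \<Longrightarrow> j \<in> B \<Longrightarrow> j' \<in> B \<Longrightarrow> m i j - m i' j - m i j' + m i' j' = 0"
  shows "\<exists>\<alpha> \<beta>. \<forall>i\<in>A. \<forall>j\<in>B. m i j = \<alpha> i + \<beta> j"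
proof (cases "A = {} \<or> B = {}")
  case False
  then obtain i0 j0 where "i0 \<in> A" "j0 \<in> B" by blast
  then have "\<forall>i\<in>A. \<forall>j\<in>B. m i j = m i j0 + (m i0 j - m i0 j0)"
    using assms[of _ i0 _ j0] by (fastforce simp: algebra_simps)
  then show ?thesis
    by (intro exI[of _ "\<lambda>i. m i j0"] exI[of _ "\<lambda>j. m i0 j - m i0 j0"])
qed auto

theorem lemma3p7:
  fixes C P :: "real ^ 'n ^ 'n" and x y :: "real ^ 'n"
    and f :: "real \<Rightarrow> real" and \<gamma> :: real
  assumes "CARD('n) \<ge> 2"
    and "strictly_convex_on {0..1} f"
    and "continuous_on {0..1} f"
    and "C1_on_Ioc01 f"
    and "x \<in> prob_simplex" and "y \<in> prob_simplex"
    and "\<gamma> > 0"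
    and "is_reg_coupling C f \<gamma> x y P"
    and "ext_deriv f 0 = -\<infinity>"
  shows "mat_supp P = mat_supp (tensor x y) \<and>
    (\<exists>\<alpha> \<beta> :: 'n \<Rightarrow> real. \<forall>(i, j) \<in> mat_supp (tensor x y).
       ereal (C $ i $ j) + ereal \<gamma> * (ext_deriv f (P $ i $ j) - ext_deriv f (x $ i * y $ j))
         = ereal (\<alpha> i + \<beta> j))"
proof -
  note conv = assms(2) and C1 = assms(4) and x = assms(5) and y = assms(6) and \<gamma> = assms(7)
    and min = assms(8) and inf = assms(9)
  let ?w = "tensor x y"
  have P: "P \<in> couplings x y"
    using min by (simp add: is_reg_coupling_def is_arg_min_def)
  note pos = minimizer_pos_on_support[OF conv C1 x y \<gamma> min inf]
  have supp: "mat_supp P = mat_supp ?w"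
    using pos coupling_zero_off_support[OF P] by (force simp: mat_supp_def)
  define m where "m = (\<lambda>i j. C $ i $ j + \<gamma> * (deriv01 f (P $ i $ j) - deriv01 f (?w $ i $ j)))"
  have "m a b - m a' b - m a b' + m a' b' = 0"
    if "a \<in> vec_supp x" "a' \<in> vec_supp x" "b \<in> vec_supp y" "b' \<in> vec_supp y" for a a' b b'
  proof -
    define u where "u = (\<lambda>i. (if i = a then 1 else 0) - (if i = a' then 1 else 0) :: real)"
    define v where "v = (\<lambda>j. (if j = b then 1 else 0) - (if j = b' then 1 else 0) :: real)"
    have sum_u: "(\<Sum>i\<in>UNIV. u i * h i) = h a - h a'" for h
      by (simp add: u_def left_diff_distrib sum_subtractf if_distrib[of "\<lambda>c. c * _"] cong: if_cong)
    have sum_v: "(\<Sum>j\<in>UNIV. v j * h j) = h b - h b'" for h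
      by (simp add: v_def left_diff_distrib sum_subtractf if_distrib[of "\<lambda>c. c * _"] cong: if_cong)
    let ?D = "\<chi> i j. u i * v j"
    have "(\<Sum>i\<in>UNIV. \<Sum>j\<in>UNIV. ?D $ i $ j * m i j) = 0"
      unfolding m_def
    proof (rule minimizer_stationary[OF conv C1 x \<gamma> min])
      show "(\<Sum>j\<in>UNIV. ?D $ i $ j) = 0" for i
        using sum_v[of "\<lambda>_. 1"] by (simp flip: sum_distrib_left)
      show "(\<Sum>i\<in>UNIV. ?D $ i $ j) = 0" for j
        using sum_u[of "\<lambda>_. 1"] by (simp flip: sum_distrib_right)
      show "0 < P $ i $ j" if "?D $ i $ j \<noteq> 0" for i j
        using that \<open>a \<in> _\<close> \<open>a' \<in> _\<close> \<open>b \<in> _\<close> \<open>b' \<in> _\<close>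
        by (intro pos) (auto simp: u_def v_def tensor_def vec_supp_def split: if_splits)
    qed
    then show ?thesis
      by (simp add: mult.assoc sum_u sum_v flip: sum_distrib_left)
  qed
  then obtain \<alpha> \<beta> where split: "\<forall>i\<in>vec_supp x. \<forall>j\<in>vec_supp y. m i j = \<alpha> i + \<beta> j"
    using split_if_mixed_differences_vanish[of "vec_supp x" "vec_supp y" m] by blast
  have "ereal (C $ i $ j) + ereal \<gamma> * (ext_deriv f (P $ i $ j) - ext_deriv f (x $ i * y $ j))
      = ereal (\<alpha> i + \<beta> j)" if ij: "(i, j) \<in> mat_supp ?w" for i j
  proof -
    have "m i j = \<alpha> i + \<beta> j"
      using split ij by (simp add: mat_supp_tensor)
    moreover have "P $ i $ j \<noteq> 0" "x $ i * y $ j \<noteq> 0"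
      using ij supp by (auto simp: mat_supp_def tensor_def)
    ultimately show ?thesis
      by (simp add: ext_deriv_def m_def tensor_def)
  qed
  with supp show ?thesis
    by blast
qed

end
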